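(* Let $E$ be a real Banach space, let $X\subset E$ be a closed set and let $Y$ be a convex set in a topological vector space. Let $I,J:E\times Y\to\mathbb{R}$ and $\alpha,\beta:E\to\mathbb{R}$. Assume that $\alpha$, $\beta$, $I(\cdot,y)$ and $J(\cdot,y)$ (for each $y\in Y$) are Gâteaux differentiable at each point of $X$. Assume also that $$\sup_{y\in Y}\inf_{x\in X}(I(x,y)-J(x,y))<\inf_{x\in X}\sup_{y\in Y}(I(x,y)-J(x,y))$$ and that $$\sup_X(\alpha+\beta)-\inf_X(\alpha+\beta)<\inf_{x\in X}\sup_{y\in Y}(I(x,y)-J(x,y))-\sup_{y\in Y}\inf_{x\in X}(I(x,y)-J(x,y)).$$ Moreover, suppose that the following conditions are satisfied: $(i_1)$ for each $y\in Y$, the function $I(\cdot,y)+\alpha(\cdot)$ is lower semicontinuous and convex in $E$; $(i_2)$ there exists a topology $\tau$ on $X$ such that, for each $y\in Y$, the function $I(\cdot,y)-J(\cdot,y)+\alpha(\cdot)+\beta(\cdot)$ is $\tau$-lower semicontinuous and $\tau$-inf-compact in $X$; $(i_3)$ for each $x\in X$, the function $I(x,\cdot)-J(x,\cdot)$ is continuous and quasi-concave in $Y$; $(i_4)$ for each $y\in Y$, and for each $u\in X$ such that $$I(u,y)-J(u,y)+\alpha(u)+\beta(u)=\inf_{x\in X}(I(x,y)-J(x,y)+\alpha(x)+\beta(x)),$$ the triple $(X,\,J(\cdot,y)-\beta(\cdot),\,I(\cdot,y)+\alpha(\cdot))$ satisfies the pointwise invariant condition at the point $u$; and assume also that, for each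 $y\in Y$, the function $J(\cdot,y)-\beta(\cdot)$ is lower semicontinuous and convex in $E$. Then, for each convex set $S\subseteq Y$, dense in $Y$, there exists $\tilde y\in S$ such that the equation $$I'_x(x,\tilde y)-J'_x(x,\tilde y)+\alpha'(x)+\beta'(x)=0$$ has at least two solutions in $X$.
   Context: Primes denote (Gâteaux) derivatives, which are elements of the dual space $E^*$; $I'_x(x,y)$ and $J'_x(x,y)$ denote the derivatives at $x$ of $I(\cdot,y)$ and $J(\cdot,y)$. Pointwise invariant condition: if $\Phi,\Psi:E\to\mathbb{R}$ are Gâteaux differentiable at each point of $X$, the triple $(X,\Phi,\Psi)$ satisfies the pointwise invariant condition at a point $u_0\in X$ if at least one of the following two facts holds: (a) there exist $v_0\in X$ and a lower semicontinuous convex Gâteaux differentiable functional $\gamma:E\to\mathbb{R}$ such that $\Phi'(u_0)+\gamma'(u_0)=\Psi'(v_0)+\gamma'(v_0)$; (b) there exist $v_0\in X$ and a lower semicontinuous convex Gâteaux differentiable functional $\gamma:E\to\mathbb{R}$, with $\gamma'(0)=0$, such that $\Phi'(u_0)=\Psi'(v_0)+\gamma'(v_0-u_0)$. A function $f:X\to\mathbb{R}$ is $\tau$-inf-compact if $\{x\in X: f(x)\leq\rho\}$ is $\tau$-compact for every $\rho\in\mathbb{R}$. A function on $Y$ is quasi-concave if all its superlevel sets $\{y\in Y: f(y)\geq\rho\}$, $\rho\in\mathbb{R}$, are convex. *)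

theory Defs
  imports "HOL-Analysis.Analysis"
begin

text \<open>Real topological vector spaces; no separation axiom is imposed.\<close>

class real_topological_vector_space = real_vector + topological_ab_group_add +
  assumes tendsto_scaleR_Pair:
    "LIM p (nhds r \<times>\<^sub>F nhds a). fst p *\<^sub>R snd p :> nhds (r *\<^sub>R a)"

instance real_normed_vector \<subseteq> real_topological_vector_space
proof
  fix r :: real and a :: 'a
  show "LIM p (nhds r \<times>\<^sub>F nhds a). fst p *\<^sub>R snd p :> nhds (r *\<^sub>R a)"
    by (intro tendsto_scaleR filterlim_fst filterlim_snd)
qed

text \<open>The Gateaux derivative at a point is an element of the dual, so it is required to be
  linear and continuous in the direction.\<close>

definition has_gateaux_derivative ::
    "('e::real_normed_vector \<Rightarrow> real) \<Rightarrow> ('e \<Rightarrow>\<^sub>L real) \<Rightarrow> 'e \<Rightarrow> bool" where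
  "has_gateaux_derivative f L x \<longleftrightarrow>
     (\<forall>v. ((\<lambda>t. (f (x + t *\<^sub>R v) - f x) / t) \<longlongrightarrow> blinfun_apply L v) (at (0::real)))"

definition gateaux_differentiable :: "('e::real_normed_vector \<Rightarrow> real) \<Rightarrow> 'e \<Rightarrow> bool" where
  "gateaux_differentiable f x \<longleftrightarrow> (\<exists>L. has_gateaux_derivative f L x)"

definition gateaux_deriv :: "('e::real_normed_vector \<Rightarrow> real) \<Rightarrow> 'e \<Rightarrow> ('e \<Rightarrow>\<^sub>L real)" where
  "gateaux_deriv f x = (THE L. has_gateaux_derivative f L x)"

lemma has_gateaux_derivative_unique:
  assumes "has_gateaux_derivative f L x" "has_gateaux_derivative f M x"
  shows "L = M"
proof (rule blinfun_eqI)
  fix v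
  show "blinfun_apply L v = blinfun_apply M v"
    using assms unfolding has_gateaux_derivative_def
    by (meson LIM_unique)
qed

lemma gateaux_deriv_eq: "has_gateaux_derivative f L x \<Longrightarrow> gateaux_deriv f x = L"
  unfolding gateaux_deriv_def by (blast intro: has_gateaux_derivative_unique)

definition lower_semicontinuous :: "'a topology \<Rightarrow> ('a \<Rightarrow> real) \<Rightarrow> bool" where
  "lower_semicontinuous T f \<longleftrightarrow> (\<forall>\<rho>. openin T {x \<in> topspace T. \<rho> < f x})"

definition inf_compact :: "'a topology \<Rightarrow> ('a \<Rightarrow> real) \<Rightarrow> bool" where
  "inf_compact T f \<longleftrightarrow> (\<forall>\<rho>. compactin T {x \<in> topspace T. f x \<le> \<rho>})"

definition quasi_concave_on :: "'a::real_vector set \<Rightarrow> ('a \<Rightarrow> real) \<Rightarrow> bool" where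
  "quasi_concave_on Y f \<longleftrightarrow> (\<forall>\<rho>. convex {y \<in> Y. \<rho> \<le> f y})"

text \<open>Intended for functions \<open>\<Phi>\<close>, \<open>\<Psi>\<close> that are Gateaux differentiable at each point of \<open>X\<close>.\<close>

definition pointwise_invariant ::
    "'e::real_normed_vector set \<Rightarrow> ('e \<Rightarrow> real) \<Rightarrow> ('e \<Rightarrow> real) \<Rightarrow> 'e \<Rightarrow> bool" where
  "pointwise_invariant X \<Phi> \<Psi> u0 \<longleftrightarrow> u0 \<in> X \<and>
     ((\<exists>v0\<in>X. \<exists>\<gamma>. lower_semicontinuous euclidean \<gamma> \<and> convex_on UNIV \<gamma> \<and>
          (\<forall>x. gateaux_differentiable \<gamma> x) \<and>
          gateaux_deriv \<Phi> u0 + gateaux_deriv \<gamma> u0 = gateaux_deriv \<Psi> v0 + gateaux_deriv \<gamma> v0)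
      \<or>
      (\<exists>v0\<in>X. \<exists>\<gamma>. lower_semicontinuous euclidean \<gamma> \<and> convex_on UNIV \<gamma> \<and>
          (\<forall>x. gateaux_differentiable \<gamma> x) \<and> gateaux_deriv \<gamma> 0 = 0 \<and>
          gateaux_deriv \<Phi> u0 = gateaux_deriv \<Psi> v0 + gateaux_deriv \<gamma> (v0 - u0)))"

end

theory Submission
  imports Defs
begin

text \<open>Put \<open>g x y = I x y - J x y + \<alpha> x + \<beta> x\<close>. The bound on the oscillation of \<open>\<alpha> + \<beta>\<close> keeps the
  minimax gap strict for \<open>g\<close>, and by density the gap survives the passage from \<open>Y\<close> to \<open>S\<close>. If every
  \<open>g(\<cdot>, y)\<close>, \<open>y \<in> S\<close>, had a unique global minimum over \<open>X\<close>, there would be no gap: by compactness it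
  suffices to treat the convex hull \<open>K\<close> of a finite set. Let \<open>y \<in> K\<close> maximise the minimal value
  \<open>h y = min g(\<cdot>, y)\<close> and let \<open>x\<close> be the minimiser for \<open>y\<close>. Then \<open>(x, y)\<close> is a saddle point, which
  only has to be checked on each segment issuing from \<open>y\<close>. So some \<open>g(\<cdot>, y)\<close> has two minima over
  \<open>X\<close>. Although these need not be interior, at each such \<open>u\<close> the pointwise invariant condition
  provides a point \<open>v \<in> X\<close> and a common linear functional that supports a perturbation of
  \<open>J - \<beta>\<close> at \<open>u\<close> and one of \<open>I + \<alpha>\<close> at \<open>v\<close>; minimality of \<open>u\<close> forces the latter to be supported
  at \<open>u\<close> as well, so the derivatives agree.\<close>

subsection \<open>Gateaux derivatives of convex functions\<close>

lemma has_gateaux_derivative_add: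
  assumes "has_gateaux_derivative f L x" "has_gateaux_derivative g M x"
  shows "has_gateaux_derivative (\<lambda>x. f x + g x) (L + M) x"
  unfolding has_gateaux_derivative_def
proof
  fix v
  have "((\<lambda>t. (f (x + t *\<^sub>R v) - f x) / t + (g (x + t *\<^sub>R v) - g x) / t)
      \<longlongrightarrow> blinfun_apply L v + blinfun_apply M v) (at 0)"
    using assms unfolding has_gateaux_derivative_def by (intro tendsto_add) auto
  then show "((\<lambda>t. (f (x + t *\<^sub>R v) + g (x + t *\<^sub>R v) - (f x + g x)) / t)
      \<longlongrightarrow> blinfun_apply (L + M) v) (at 0)"
    by (simp add: blinfun.add_left add_divide_distrib[symmetric] algebra_simps)
qed

lemma has_gateaux_derivative_diff:
  assumes "has_gateaux_derivative f L x" "has_gateaux_derivative g M x"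
  shows "has_gateaux_derivative (\<lambda>x. f x - g x) (L - M) x"
  unfolding has_gateaux_derivative_def
proof
  fix v
  have "((\<lambda>t. (f (x + t *\<^sub>R v) - f x) / t - (g (x + t *\<^sub>R v) - g x) / t)
      \<longlongrightarrow> blinfun_apply L v - blinfun_apply M v) (at 0)"
    using assms unfolding has_gateaux_derivative_def by (intro tendsto_diff) auto
  then show "((\<lambda>t. (f (x + t *\<^sub>R v) - g (x + t *\<^sub>R v) - (f x - g x)) / t)
      \<longlongrightarrow> blinfun_apply (L - M) v) (at 0)"
    by (simp add: blinfun.diff_left diff_divide_distrib[symmetric] algebra_simps)
qed

lemma has_gateaux_derivative_shift:
  assumes "has_gateaux_derivative f L (x - a)"
  shows "has_gateaux_derivative (\<lambda>x. f (x - a)) L x"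
  using assms by (simp add: has_gateaux_derivative_def algebra_simps)

lemma has_gateaux_derivative_gateaux_deriv:
  "gateaux_differentiable f x \<Longrightarrow> has_gateaux_derivative f (gateaux_deriv f x) x"
  using gateaux_deriv_eq unfolding gateaux_differentiable_def by blast

lemma gateaux_differentiable_add:
  "gateaux_differentiable f x \<Longrightarrow> gateaux_differentiable g x
    \<Longrightarrow> gateaux_differentiable (\<lambda>x. f x + g x) x"
  unfolding gateaux_differentiable_def by (blast intro: has_gateaux_derivative_add)

lemma gateaux_differentiable_diff:
  "gateaux_differentiable f x \<Longrightarrow> gateaux_differentiable g x
    \<Longrightarrow> gateaux_differentiable (\<lambda>x. f x - g x) x"
  unfolding gateaux_differentiable_def by (blast intro: has_gateaux_derivative_diff)

lemma gateaux_deriv_add: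
  "gateaux_differentiable f x \<Longrightarrow> gateaux_differentiable g x
    \<Longrightarrow> gateaux_deriv (\<lambda>x. f x + g x) x = gateaux_deriv f x + gateaux_deriv g x"
  by (intro gateaux_deriv_eq has_gateaux_derivative_add has_gateaux_derivative_gateaux_deriv)

lemma gateaux_deriv_diff:
  "gateaux_differentiable f x \<Longrightarrow> gateaux_differentiable g x
    \<Longrightarrow> gateaux_deriv (\<lambda>x. f x - g x) x = gateaux_deriv f x - gateaux_deriv g x"
  by (intro gateaux_deriv_eq has_gateaux_derivative_diff has_gateaux_derivative_gateaux_deriv)

text \<open>Convexity bounds each difference quotient along the segment from \<open>u\<close> to
  \<open>w\<close>, for parameters in (0, 1), by \<open>f w - f u\<close>; the bound passes to the
  one-sided limit.\<close>

lemma convex_above_gateaux_tangent: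
  assumes "convex_on UNIV f" "has_gateaux_derivative f L u"
  shows "f u + blinfun_apply L (w - u) \<le> f w"
proof -
  have "((\<lambda>t. (f (u + t *\<^sub>R (w - u)) - f u) / t) \<longlongrightarrow> blinfun_apply L (w - u)) (at_right 0)"
    using assms(2) unfolding has_gateaux_derivative_def
    by (meson at_le filterlim_mono order_refl subset_UNIV)
  moreover have "\<forall>\<^sub>F t in at_right 0. (f (u + t *\<^sub>R (w - u)) - f u) / t \<le> f w - f u"
  proof -
    have "\<forall>\<^sub>F t in at_right (0::real). t \<in> {0<..<1}"
      by (rule eventually_at_right_real) simp
    then show ?thesis
    proof eventually_elim
      case (elim t)
      have "f ((1 - t) *\<^sub>R u + t *\<^sub>R w) \<le> (1 - t) * f u + t * f w"
        using elim by (intro convex_onD[OF assms(1)]) auto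
      moreover have "(1 - t) *\<^sub>R u + t *\<^sub>R w = u + t *\<^sub>R (w - u)"
        by (simp add: algebra_simps)
      ultimately show ?case
        using elim by (simp add: divide_le_eq) (simp add: algebra_simps)
    qed
  qed
  ultimately have "blinfun_apply L (w - u) \<le> f w - f u"
    by (rule tendsto_upperbound) simp
  then show ?thesis by simp
qed

text \<open>One-sided quotients give \<open>p v <= L v\<close> in every direction; the same bound at
  \<open>- v\<close> turns this into equality.\<close>

lemma gateaux_derivative_eq_supporting:
  assumes "\<And>w. f u + blinfun_apply p (w - u) \<le> f w" "has_gateaux_derivative f L u"
  shows "L = p"
proof (rule blinfun_eqI)
  have *: "blinfun_apply p v \<le> blinfun_apply L v" for v
  proof -
    have "((\<lambda>t. (f (u + t *\<^sub>R v) - f u) / t) \<longlongrightarrow> blinfun_apply L v) (at_right 0)"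
      using assms(2) unfolding has_gateaux_derivative_def
      by (meson at_le filterlim_mono order_refl subset_UNIV)
    moreover have "\<forall>\<^sub>F t in at_right 0. blinfun_apply p v \<le> (f (u + t *\<^sub>R v) - f u) / t"
      using eventually_at_right_less[of 0]
    proof eventually_elim
      case (elim t)
      then show ?case
        using assms(1)[of "u + t *\<^sub>R v"] by (simp add: blinfun.scaleR_right field_simps)
    qed
    ultimately show ?thesis
      by (rule tendsto_lowerbound) simp
  qed
  show "blinfun_apply L v = blinfun_apply p v" for v
    using *[of v] *[of "- v"] by (simp add: blinfun.minus_right)
qed

text \<open>Adding \<gamma>, or its translate by \<open>u\<close>, to both functions leaves \<Psi> -
  \<Phi> unchanged, and one functional then supports the perturbed \<Phi> at \<open>u\<close> and
  the perturbed \<Psi> at \<open>v\<close>. Comparing \<open>u\<close> with \<open>v\<close> by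
  minimality moves the second support from \<open>v\<close> to \<open>u\<close>.\<close>

lemma pointwise_invariant_gateaux_deriv_eq:
  assumes inv: "pointwise_invariant X \<Phi> \<Psi> u"
    and diff: "\<And>x. x \<in> X \<Longrightarrow> gateaux_differentiable \<Phi> x"
      "\<And>x. x \<in> X \<Longrightarrow> gateaux_differentiable \<Psi> x"
    and conv: "convex_on UNIV \<Phi>" "convex_on UNIV \<Psi>"
    and min: "\<And>x. x \<in> X \<Longrightarrow> \<Psi> u - \<Phi> u \<le> \<Psi> x - \<Phi> x"
  shows "gateaux_deriv \<Psi> u = gateaux_deriv \<Phi> u"
proof -
  note D = has_gateaux_derivative_gateaux_deriv
  note tangent = convex_above_gateaux_tangent
  have u: "u \<in> X" using inv by (simp add: pointwise_invariant_def)
  let ?p = "gateaux_deriv \<Phi> u"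
  consider v \<gamma> where "v \<in> X" "convex_on UNIV \<gamma>" "\<And>x. gateaux_differentiable \<gamma> x"
      "?p + gateaux_deriv \<gamma> u = gateaux_deriv \<Psi> v + gateaux_deriv \<gamma> v"
    | v \<gamma> where "v \<in> X" "convex_on UNIV \<gamma>" "\<And>x. gateaux_differentiable \<gamma> x"
      "gateaux_deriv \<gamma> 0 = 0" "?p = gateaux_deriv \<Psi> v + gateaux_deriv \<gamma> (v - u)"
    using inv unfolding pointwise_invariant_def by blast
  then show ?thesis
  proof cases
    case (1 v \<gamma>)
    let ?q = "?p + gateaux_deriv \<gamma> u"
    have "\<Psi> u + \<gamma> u + blinfun_apply ?q (w - u) \<le> \<Psi> w + \<gamma> w" for w
    proof -
      have "\<Phi> u + \<gamma> u + blinfun_apply ?q (v - u) \<le> \<Phi> v + \<gamma> v"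
        using tangent[OF conv(1) D[OF diff(1)[OF u]], of v]
          tangent[OF 1(2) D[OF 1(3)], of u v] by (simp add: blinfun.add_left)
      moreover have "\<Psi> v + \<gamma> v + blinfun_apply ?q (w - v) \<le> \<Psi> w + \<gamma> w"
        using tangent[OF conv(2) D[OF diff(2)[OF 1(1)]], of w]
          tangent[OF 1(2) D[OF 1(3)], of v w] unfolding 1(4) by (simp add: blinfun.add_left)
      ultimately show ?thesis
        using min[OF 1(1)] by (simp add: blinfun.diff_right)
    qed
    then have "gateaux_deriv \<Psi> u + gateaux_deriv \<gamma> u = ?q"
      by (rule gateaux_derivative_eq_supporting)
        (intro has_gateaux_derivative_add D diff u 1)
    then show ?thesis by simp
  next
    case (2 v \<gamma>)
    have "\<Psi> u + \<gamma> (u - u) + blinfun_apply ?p (w - u) \<le> \<Psi> w + \<gamma> (w - u)" for w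
    proof -
      have "\<Phi> u + blinfun_apply ?p (v - u) \<le> \<Phi> v"
        by (rule tangent[OF conv(1) D[OF diff(1)[OF u]]])
      \<comment> \<open>Convexity and the vanishing derivative make 0 a global minimum of \<gamma>,
        so the translate adds nothing to the functional \<open>?p\<close> at
        \<open>u\<close>.\<close>
      moreover have "\<gamma> 0 \<le> \<gamma> (v - u)"
        using tangent[OF 2(2) D[OF 2(3)], of 0 "v - u"] by (simp add: 2(4))
      moreover have "\<Psi> v + \<gamma> (v - u) + blinfun_apply ?p (w - v) \<le> \<Psi> w + \<gamma> (w - u)"
        using tangent[OF conv(2) D[OF diff(2)[OF 2(1)]], of w]
          tangent[OF 2(2) D[OF 2(3)], of "v - u" "w - u"] unfolding 2(5)
        by (simp add: blinfun.add_left)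
      ultimately show ?thesis
        using min[OF 2(1)] by (simp add: blinfun.diff_right)
    qed
    then have "gateaux_deriv \<Psi> u + gateaux_deriv \<gamma> (u - u) = ?p"
      by (rule gateaux_derivative_eq_supporting)
        (intro has_gateaux_derivative_add has_gateaux_derivative_shift D diff u 2)
    then show ?thesis by (simp add: 2(4))
  qed
qed

subsection \<open>Compactness in topological vector spaces and of sublevel sets\<close>

lemma tendsto_scaleR_tvs:
  fixes g :: "'a \<Rightarrow> 'b::real_topological_vector_space"
  assumes "(f \<longlongrightarrow> r) F" "(g \<longlongrightarrow> a) F"
  shows "((\<lambda>x. f x *\<^sub>R g x) \<longlongrightarrow> r *\<^sub>R a) F"
  using filterlim_compose[OF tendsto_scaleR_Pair filterlim_Pair[OF assms]] by simp

lemma continuous_on_scaleR_tvs: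
  fixes g :: "'a::topological_space \<Rightarrow> 'b::real_topological_vector_space"
  assumes "continuous_on A f" "continuous_on A g"
  shows "continuous_on A (\<lambda>x. f x *\<^sub>R g x)"
  using assms by (auto simp: continuous_on_def intro!: tendsto_scaleR_tvs)

text \<open>By induction: adjoining \<open>a\<close> to a nonempty set makes the new hull a
  continuous image of the unit interval times the old hull.\<close>

lemma compact_convex_hull_finite_tvs:
  fixes F :: "'b::real_topological_vector_space set"
  assumes "finite F"
  shows "compact (convex hull F)"
  using assms
proof induction
  case empty
  then show ?case by simp
next
  case (insert a F)
  show ?case
  proof (cases "F = {}")
    case False
    have "convex hull insert a F
        = (\<lambda>(t, b). (1 - t) *\<^sub>R a + t *\<^sub>R b) ` ({0..1} \<times> (convex hull F))"
      unfolding convex_hull_insert_alt if_not_P[OF False] by force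
    moreover have "compact \<dots>"
      using insert.IH unfolding case_prod_unfold
      by (intro compact_continuous_image compact_Times compact_Icc continuous_on_add
          continuous_on_scaleR_tvs continuous_intros)
    ultimately show ?thesis by simp
  qed simp
qed

lemma lower_semicontinuous_closedin_sublevel:
  assumes "lower_semicontinuous T f"
  shows "closedin T {x \<in> topspace T. f x \<le> \<rho>}"
proof -
  have "topspace T - {x \<in> topspace T. f x \<le> \<rho>} = {x \<in> topspace T. \<rho> < f x}"
    by auto
  then show ?thesis
    using assms by (auto simp: closedin_def lower_semicontinuous_def)
qed

lemma lower_semicontinuous_imp_inf_compact:
  assumes "compact_space T" "lower_semicontinuous T f"
  shows "inf_compact T f"
  using assms closedin_compact_space lower_semicontinuous_closedin_sublevel
  unfolding inf_compact_def by blast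

text \<open>One sublevel set is compact and all are closed, so the finite intersection property
  applies inside it. The level may vary with the index, which also allows minimisers to be produced
  this way.\<close>

lemma inf_compact_sublevel_fip:
  fixes f :: "'i \<Rightarrow> 'a \<Rightarrow> real"
  assumes "A \<noteq> {}"
    and lsc: "\<And>i. i \<in> A \<Longrightarrow> lower_semicontinuous T (f i)"
    and cpt: "\<And>i. i \<in> A \<Longrightarrow> inf_compact T (f i)"
    and fip: "\<And>F. finite F \<Longrightarrow> F \<noteq> {} \<Longrightarrow> F \<subseteq> A
                \<Longrightarrow> \<exists>x\<in>topspace T. \<forall>i\<in>F. f i x \<le> \<rho> i"
  shows "\<exists>x\<in>topspace T. \<forall>i\<in>A. f i x \<le> \<rho> i"
proof -
  let ?C = "\<lambda>i. {x \<in> topspace T. f i x \<le> \<rho> i}"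
  obtain k where k: "k \<in> A" using assms(1) by blast
  have "?C k \<inter> \<Inter>\<G> \<noteq> {}" if \<G>: "finite \<G>" "\<G> \<subseteq> ?C ` A" for \<G>
  proof -
    obtain F where F: "F \<subseteq> A" "finite F" "\<G> = ?C ` F"
      using finite_subset_image[OF \<G>] by blast
    obtain x where "x \<in> topspace T" "\<forall>i\<in>insert k F. f i x \<le> \<rho> i"
      using fip[of "insert k F"] F k by auto
    then show ?thesis using F(3) by auto
  qed
  moreover have "compactin T (?C k)"
    using cpt[OF k] by (simp add: inf_compact_def)
  moreover have "\<forall>C\<in>?C ` A. closedin T C"
    using lsc lower_semicontinuous_closedin_sublevel by blast
  ultimately have "?C k \<inter> \<Inter>(?C ` A) \<noteq> {}"
    unfolding compactin_fip by blast
  then show ?thesis by auto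
qed

text \<open>The points \<open>z\<close> serve as indices of a constant family with levels
  \<open>f z\<close>; a finite subfamily is met at its point of least value.\<close>

lemma inf_compact_attains_min:
  assumes "topspace T \<noteq> {}" "lower_semicontinuous T f" "inf_compact T f"
  shows "\<exists>x\<in>topspace T. \<forall>z\<in>topspace T. f x \<le> f z"
proof (rule inf_compact_sublevel_fip)
  fix F assume F: "finite F" "F \<noteq> {}" "F \<subseteq> topspace T"
  then have "arg_min_on f F \<in> F" "\<forall>i\<in>F. f (arg_min_on f F) \<le> f i"
    by (auto intro: arg_min_if_finite(1) arg_min_least)
  then show "\<exists>x\<in>topspace T. \<forall>i\<in>F. f x \<le> f i"
    using F(3) by blast
qed (use assms in auto)

subsection \<open>Minimax equality under uniqueness of the minima\<close>

lemma quasi_concave_on_interval: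
  fixes f :: "real \<Rightarrow> real"
  assumes "quasi_concave_on {a..b} f" "a \<le> r" "r \<le> s" "s \<le> t" "t \<le> b"
  shows "min (f r) (f t) \<le> f s"
proof -
  let ?S = "{x \<in> {a..b}. min (f r) (f t) \<le> f x}"
  have "is_interval ?S"
    using assms(1) unfolding quasi_concave_on_def is_interval_convex_1 by blast
  moreover have "r \<in> ?S" "t \<in> ?S" using assms(2-) by auto
  ultimately have "s \<in> ?S" using assms(3,4) by (rule mem_is_interval_1_I)
  then show ?thesis by simp
qed

text \<open>Let \<open>a\<close> be the last parameter at which \<open>x0\<close> is still the minimiser. The minimisers for \<open>s > a\<close>
  stay in the sublevel sets of all parameters in \<open>[s, 1]\<close>; letting \<open>s\<close> decrease to \<open>a\<close>, compactness
  yields a point that also minimises at \<open>a\<close>, hence is \<open>x0\<close>, yet lies below the level at 1.\<close>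

lemma segment_saddle_point:
  fixes g :: "'a \<Rightarrow> real \<Rightarrow> real"
  assumes lsc: "\<And>t. t \<in> {0..1} \<Longrightarrow> lower_semicontinuous T (\<lambda>x. g x t)"
    and cpt: "\<And>t. t \<in> {0..1} \<Longrightarrow> inf_compact T (\<lambda>x. g x t)"
    and cont: "\<And>x. x \<in> topspace T \<Longrightarrow> continuous_on {0..1} (g x)"
    and qc: "\<And>x. x \<in> topspace T \<Longrightarrow> quasi_concave_on {0..1} (g x)"
    and unique: "\<And>t x x'. t \<in> {0..1} \<Longrightarrow> x \<in> topspace T \<Longrightarrow> x' \<in> topspace T
          \<Longrightarrow> \<forall>z\<in>topspace T. g x t \<le> g z t \<Longrightarrow> \<forall>z\<in>topspace T. g x' t \<le> g z t \<Longrightarrow> x = x'"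
    and x0: "x0 \<in> topspace T" "\<And>z. z \<in> topspace T \<Longrightarrow> g x0 0 \<le> g z 0"
    and max: "\<And>t. t \<in> {0..1} \<Longrightarrow> \<exists>x\<in>topspace T. g x t \<le> g x0 0"
  shows "g x0 1 \<le> g x0 0"
proof (rule ccontr)
  assume contra: "\<not> ?thesis"
  define c where "c = g x0 0"
  have gt: "c < g x0 1" using contra by (simp add: c_def)
  define A where "A = {t \<in> {0..1}. \<forall>x\<in>topspace T. g x0 t \<le> g x t}"
  have "A = {0..1} \<inter> (\<Inter>x\<in>topspace T. {t \<in> {0..1}. g x0 t \<le> g x t})"
    by (auto simp: A_def)
  moreover have "closed {t \<in> {0..1}. g x0 t \<le> g x t}" if "x \<in> topspace T" for x
    using that x0(1) by (intro continuous_on_closed_Collect_le cont) auto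
  ultimately have "compact A"
    by (auto intro!: compact_Int_closed)
  moreover have "0 \<in> A" using x0(2) by (simp add: A_def)
  ultimately obtain a where a: "a \<in> A" "\<And>t. t \<in> A \<Longrightarrow> t \<le> a"
    using compact_attains_sup[of A] by blast
  have a01: "0 \<le> a" "a \<le> 1" and mina: "\<forall>x\<in>topspace T. g x0 a \<le> g x a"
    using a(1) by (auto simp: A_def)
  \<comment> \<open>By \<open>max\<close>, some value at parameter 1 is at most
    \<open>c < g x0 1\<close>, so \<open>x0\<close> is no minimiser there.\<close>
  have "a \<noteq> 1"
    using max[of 1] mina gt by (force simp: c_def)
  then have "a < 1" using a01 by simp
  have beyond: "\<exists>x\<in>topspace T. \<forall>t\<in>{s..1}. g x t \<le> c" if s: "a < s" "s \<le> 1" for s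
  proof -
    have s01: "s \<in> {0..1}" using s a01 by simp
    obtain x where x: "x \<in> topspace T" "\<forall>z\<in>topspace T. g x s \<le> g z s"
      using inf_compact_attains_min[OF _ lsc[OF s01] cpt[OF s01]] x0(1) by blast
    have gs: "g x s \<le> c" using max[OF s01] x(2) by (force simp: c_def)
    have "s \<notin> A" using a(2)[of s] s by auto
    then have "x \<noteq> x0" using x s01 by (auto simp: A_def)
    \<comment> \<open>A value at most \<open>c\<close> at 0 would make \<open>x\<close> a second
      minimiser there. Being above \<open>c\<close> at 0 and again at some \<open>t\<close> in
      [s, 1] would force \<open>g x s\<close> above \<open>c\<close> by quasi-concavity.\<close>
    then have "\<not> g x 0 \<le> c"
      using unique[of 0 x x0] x(1) x0 unfolding c_def by force
    then have "g x t \<le> c" if "t \<in> {s..1}" for t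
      using quasi_concave_on_interval[OF qc[OF x(1)], of 0 s t] that s01 gs by auto
    then show ?thesis using x(1) by blast
  qed
  have "\<exists>x\<in>topspace T. \<forall>s\<in>{a<..1}. g x s \<le> c"
  proof (rule inf_compact_sublevel_fip)
    fix F assume F: "finite F" "F \<noteq> {}" "F \<subseteq> {a<..1}"
    then have "Min F \<in> {a<..1}" using Min_in by blast
    \<comment> \<open>The point found for the smallest parameter serves all of
      \<open>F\<close>.\<close>
    then obtain x where "x \<in> topspace T" "\<forall>t\<in>{Min F..1}. g x t \<le> c"
      using beyond[of "Min F"] by auto
    then show "\<exists>x\<in>topspace T. \<forall>s\<in>F. g x s \<le> c"
      using F by (metis Min_le atLeastAtMost_iff greaterThanAtMost_iff subsetD)
  qed (use \<open>a < 1\<close> a01 lsc cpt in auto)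
  then obtain x where x: "x \<in> topspace T" "\<And>s. s \<in> {a<..1} \<Longrightarrow> g x s \<le> c" by blast
  have "g x a \<le> c"
  proof (rule tendsto_upperbound)
    have "(g x \<longlongrightarrow> g x a) (at a within {0..1})"
      using cont[OF x(1)] a01 by (simp add: continuous_on_def)
    then have "(g x \<longlongrightarrow> g x a) (at a within {a..1})"
      by (rule tendsto_within_subset) (use a01 in auto)
    then show "(g x \<longlongrightarrow> g x a) (at_right a)"
      using \<open>a < 1\<close> by (simp add: at_within_Icc_at_right)
    have "\<forall>\<^sub>F s in at_right a. s \<in> {a<..<1}"
      using \<open>a < 1\<close> by (rule eventually_at_right_real)
    then show "\<forall>\<^sub>F s in at_right a. g x s \<le> c"
      by eventually_elim (use x(2) in auto)
  qed simp
  \<comment> \<open>\<open>x0\<close> has values at least \<open>c\<close> at both ends of the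
    segment, hence at \<open>a\<close>; so \<open>x\<close> is a minimiser at \<open>a\<close>
    too.\<close>
  also have "c \<le> g x0 a"
    using quasi_concave_on_interval[OF qc[OF x0(1)], of 0 a 1] a01 gt by (simp add: c_def)
  finally have "\<forall>z\<in>topspace T. g x a \<le> g z a"
    using mina by force
  then have "x = x0"
    using unique[of a x x0] x(1) x0(1) mina a01 by auto
  then show False
    using x(2)[of 1] \<open>a < 1\<close> gt by auto
qed

text \<open>A real level \<open>r\<close> stands in for the two minimax values. For a finite
  \<open>F\<close>, the minimiser belonging to the best parameter in the hull of \<open>F\<close>
  serves all of \<open>F\<close>.\<close>

lemma minimax_unique_minimum:
  fixes g :: "'a \<Rightarrow> 'b::real_topological_vector_space \<Rightarrow> real"
  assumes "topspace T \<noteq> {}" "convex S" "S \<noteq> {}"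
    and lsc: "\<And>y. y \<in> S \<Longrightarrow> lower_semicontinuous T (\<lambda>x. g x y)"
    and cpt: "\<And>y. y \<in> S \<Longrightarrow> inf_compact T (\<lambda>x. g x y)"
    and cont: "\<And>x. x \<in> topspace T \<Longrightarrow> continuous_on S (g x)"
    and qc: "\<And>x. x \<in> topspace T \<Longrightarrow> quasi_concave_on S (g x)"
    and unique: "\<And>y x x'. y \<in> S \<Longrightarrow> x \<in> topspace T \<Longrightarrow> x' \<in> topspace T
          \<Longrightarrow> \<forall>z\<in>topspace T. g x y \<le> g z y \<Longrightarrow> \<forall>z\<in>topspace T. g x' y \<le> g z y \<Longrightarrow> x = x'"
    and below: "\<And>y. y \<in> S \<Longrightarrow> \<exists>x\<in>topspace T. g x y \<le> r"
  shows "\<exists>x\<in>topspace T. \<forall>y\<in>S. g x y \<le> r"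
proof (rule inf_compact_sublevel_fip)
  fix F assume F: "finite F" "F \<noteq> {}" "F \<subseteq> S"
  define K where "K = convex hull F"
  have KS: "K \<subseteq> S" using F(3) \<open>convex S\<close> by (simp add: K_def hull_minimal)
  have FK: "F \<subseteq> K" by (simp add: K_def hull_subset)
  have "\<forall>y\<in>S. \<exists>x\<in>topspace T. \<forall>z\<in>topspace T. g x y \<le> g z y"
    using inf_compact_attains_min[OF assms(1) lsc cpt] by blast
  then obtain \<xi> where \<xi>: "\<And>y. y \<in> S \<Longrightarrow> \<xi> y \<in> topspace T"
      "\<And>y z. y \<in> S \<Longrightarrow> z \<in> topspace T \<Longrightarrow> g (\<xi> y) y \<le> g z y"
    by metis
  \<comment> \<open>The minimal value is an infimum of functions continuous in \<open>y\<close>,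
    hence upper semicontinuous, and so attains a maximum on the compact \<open>K\<close>.\<close>
  have "lower_semicontinuous (top_of_set K) (\<lambda>y. - g (\<xi> y) y)"
    unfolding lower_semicontinuous_def
  proof
    fix \<rho>
    have "{y \<in> K. \<rho> < - g (\<xi> y) y} = (\<Union>x\<in>topspace T. {y \<in> K. g x y < - \<rho>})"
    proof safe
      fix y assume "y \<in> K" "\<rho> < - g (\<xi> y) y"
      then show "y \<in> (\<Union>x\<in>topspace T. {y \<in> K. g x y < - \<rho>})"
        using \<xi>(1)[of y] KS by force
    next
      fix y x assume "y \<in> K" "x \<in> topspace T" "g x y < - \<rho>"
      then show "\<rho> < - g (\<xi> y) y"
        using \<xi>(2)[of y x] KS by force
    qed
    moreover have "openin (top_of_set K) {y \<in> K. g x y < - \<rho>}" if "x \<in> topspace T" for x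
    proof -
      have "openin (top_of_set K) (K \<inter> g x -` {..< - \<rho>})"
        using continuous_on_subset[OF cont[OF that] KS]
        by (intro continuous_openin_preimage_gen) auto
      moreover have "K \<inter> g x -` {..< - \<rho>} = {y \<in> K. g x y < - \<rho>}" by auto
      ultimately show ?thesis by simp
    qed
    ultimately show "openin (top_of_set K)
        {y \<in> topspace (top_of_set K). \<rho> < - g (\<xi> y) y}"
      by (auto intro: openin_Union)
  qed
  moreover have "compact_space (top_of_set K)"
    using compact_convex_hull_finite_tvs[OF F(1)]
    by (simp add: K_def compact_space_subtopology)
  moreover have "topspace (top_of_set K) \<noteq> {}" using F(2) FK by auto
  ultimately have "\<exists>y\<in>topspace (top_of_set K). \<forall>z\<in>topspace (top_of_set K).
      - g (\<xi> y) y \<le> - g (\<xi> z) z"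
    by (intro inf_compact_attains_min lower_semicontinuous_imp_inf_compact)
  then obtain y where y: "y \<in> K" "\<And>z. z \<in> K \<Longrightarrow> g (\<xi> z) z \<le> g (\<xi> y) y"
    by auto
  have yS: "y \<in> S" using y(1) KS by blast
  have "g (\<xi> y) z \<le> r" if z: "z \<in> F" for z
  proof -
    let ?l = "\<lambda>t. (1 - t) *\<^sub>R y + t *\<^sub>R z"
    have lK: "?l t \<in> K" if "t \<in> {0..1}" for t
      using that y(1) z FK convexD_alt[OF convex_convex_hull[of F], of y z t]
      by (auto simp: K_def)
    have lS: "?l t \<in> S" if "t \<in> {0..1}" for t using lK[OF that] KS by blast
    \<comment> \<open>The segment stays in \<open>K\<close>, so maximality of \<open>y\<close>
      supplies the hypothesis \<open>max\<close>; its end at parameter 1 is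
      \<open>z\<close>.\<close>
    have "g (\<xi> y) (?l 1) \<le> g (\<xi> y) (?l 0)"
    proof (rule segment_saddle_point[where T = T])
      fix x assume x: "x \<in> topspace T"
      show "continuous_on {0..1} (\<lambda>t. g x (?l t))"
        by (rule continuous_on_compose2[OF cont[OF x]])
          (use lS in \<open>auto intro!: continuous_on_add continuous_on_scaleR_tvs continuous_intros\<close>)
      show "quasi_concave_on {0..1} (\<lambda>t. g x (?l t))"
        unfolding quasi_concave_on_def
      proof
        fix \<rho>
        have conv: "convex {y \<in> S. \<rho> \<le> g x y}"
          using qc[OF x] by (simp add: quasi_concave_on_def)
        show "convex {t \<in> {0..1}. \<rho> \<le> g x (?l t)}"
        proof (rule convexI)
          fix s t u v :: real
          assume s: "s \<in> {t \<in> {0..1}. \<rho> \<le> g x (?l t)}"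
            and t: "t \<in> {t \<in> {0..1}. \<rho> \<le> g x (?l t)}"
            and uv: "0 \<le> u" "0 \<le> v" "u + v = 1"
          \<comment> \<open>Affinity of the path pulls convex superlevel sets back to convex sets of
            parameters.\<close>
          have "?l (u *\<^sub>R s + v *\<^sub>R t) = u *\<^sub>R ?l s + v *\<^sub>R ?l t"
          proof -
            have "u *\<^sub>R y + v *\<^sub>R y = y"
              using uv(3) by (simp add: scaleR_add_left[symmetric])
            then show ?thesis by (simp add: algebra_simps)
          qed
          moreover have "u *\<^sub>R ?l s + v *\<^sub>R ?l t \<in> {y \<in> S. \<rho> \<le> g x y}"
            by (rule convexD[OF conv]) (use s t uv lS in auto)
          moreover have "u *\<^sub>R s + v *\<^sub>R t \<in> {0..1}"
            by (rule convexD) (use s t uv in auto)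
          ultimately show "u *\<^sub>R s + v *\<^sub>R t \<in> {t \<in> {0..1}. \<rho> \<le> g x (?l t)}"
            by simp
        qed
      qed
    next
      fix t :: real assume "t \<in> {0..1}"
      then show "\<exists>x\<in>topspace T. g x (?l t) \<le> g (\<xi> y) (?l 0)"
        using y(2)[OF lK] \<xi>(1)[OF lS] by auto
    next
      fix t x x'
      assume "t \<in> {0..1}" "x \<in> topspace T" "x' \<in> topspace T"
        "\<forall>z\<in>topspace T. g x (?l t) \<le> g z (?l t)" "\<forall>z\<in>topspace T. g x' (?l t) \<le> g z (?l t)"
      then show "x = x'" using unique[OF lS] by blast
    qed (use lsc cpt lS \<xi> yS in auto)
    also have "\<dots> \<le> r"
      using below[OF yS] \<xi>(2)[OF yS] by force
    finally show ?thesis by simp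
  qed
  then show "\<exists>x\<in>topspace T. \<forall>y\<in>F. g x y \<le> r"
    using \<xi>(1)[OF yS] by blast
qed (use assms in auto)

subsection \<open>Two critical points\<close>

text \<open>Adding \<phi> raises the sup-inf by at most sup \<phi> and the inf-sup by at least inf
  \<phi>, so a gap wider than the oscillation survives.\<close>

lemma minimax_gap_level:
  fixes f :: "'a \<Rightarrow> 'b \<Rightarrow> real"
  assumes "X \<noteq> {}" "Y \<noteq> {}"
    \<comment> \<open>not implied by \<open>gap\<close>, since \<open>\<infinity> - \<infinity> = \<infinity>\<close> in \<open>ereal\<close>\<close>
    and less: "(SUP y\<in>Y. INF x\<in>X. ereal (f x y)) < (INF x\<in>X. SUP y\<in>Y. ereal (f x y))"
    and gap: "(SUP x\<in>X. ereal (\<phi> x)) - (INF x\<in>X. ereal (\<phi> x))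
      < (INF x\<in>X. SUP y\<in>Y. ereal (f x y)) - (SUP y\<in>Y. INF x\<in>X. ereal (f x y))"
    and bdd: "\<And>y. y \<in> Y \<Longrightarrow> \<exists>m. \<forall>x\<in>X. m \<le> f x y + \<phi> x"
  obtains r where "\<And>y. y \<in> Y \<Longrightarrow> \<exists>x\<in>X. f x y + \<phi> x < r"
    and "\<And>x. x \<in> X \<Longrightarrow> \<exists>y\<in>Y. r < f x y + \<phi> x"
proof -
  obtain x0 where x0: "x0 \<in> X" using assms(1) by blast
  obtain y0 where y0: "y0 \<in> Y" using assms(2) by blast
  define M where "M = (SUP x\<in>X. ereal (\<phi> x))"
  define m where "m = (INF x\<in>X. ereal (\<phi> x))"
  define A where "A = (SUP y\<in>Y. INF x\<in>X. ereal (f x y))"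
  define B where "B = (INF x\<in>X. SUP y\<in>Y. ereal (f x y))"
  have gap': "M - m < B - A" using gap by (simp add: M_def m_def A_def B_def)
  have "ereal (\<phi> x0) \<le> M" "m \<le> ereal (\<phi> x0)"
    using x0 by (auto simp: M_def m_def intro: SUP_upper INF_lower)
  \<comment> \<open>An infinite supremum or infimum of \<phi> would make the left side of
    \<open>gap'\<close> infinite.\<close>
  then obtain M' m' where Mm: "M = ereal M'" "m = ereal m'"
    using gap' by (cases M; cases m) auto
  have M': "\<phi> x \<le> M'" and m': "m' \<le> \<phi> x" if "x \<in> X" for x
    using SUP_upper[OF that, of "\<lambda>x. ereal (\<phi> x)"] INF_lower[OF that, of "\<lambda>x. ereal (\<phi> x)"] Mm
    by (auto simp: M_def m_def)
  \<comment> \<open>The lower bound at \<open>y0\<close> keeps \<open>A\<close> off minus infinity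
    and \<open>less\<close> keeps it off plus infinity; \<open>B\<close> may still be
    infinite.\<close>
  obtain k where k: "\<forall>x\<in>X. k \<le> f x y0 + \<phi> x" using bdd[OF y0] by blast
  have "ereal (k - M') \<le> (INF x\<in>X. ereal (f x y0))"
  proof (rule INF_greatest)
    fix x assume "x \<in> X"
    then show "ereal (k - M') \<le> ereal (f x y0)"
      using k M'[of x] by force
  qed
  also have "\<dots> \<le> A" unfolding A_def using y0 by (rule SUP_upper)
  finally obtain A' where A: "A = ereal A'"
    using less unfolding A_def[symmetric] B_def[symmetric] by (cases A) auto
  have "ereal (M' - m' + A') < B"
    using gap' Mm A by (cases B) auto
  then obtain s where s: "ereal (M' - m' + A') < ereal s" "ereal s < B"
    using ereal_dense2 by metis
  show thesis
  proof (rule that[of "s + m'"])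
    fix y assume y: "y \<in> Y"
    have "(INF x\<in>X. ereal (f x y)) \<le> A" unfolding A_def using y by (rule SUP_upper)
    also have "A < ereal (s + m' - M')" using s(1) A by simp
    finally obtain x where "x \<in> X" "f x y < s + m' - M'"
      by (auto simp: INF_less_iff)
    then show "\<exists>x\<in>X. f x y + \<phi> x < s + m'"
      using M'[of x] by force
  next
    fix x assume x: "x \<in> X"
    have "B \<le> (SUP y\<in>Y. ereal (f x y))" unfolding B_def using x by (rule INF_lower)
    with s(2) have "ereal s < (SUP y\<in>Y. ereal (f x y))" by simp
    then obtain y where "y \<in> Y" "s < f x y"
      by (auto simp: less_SUP_iff)
    then show "\<exists>y\<in>Y. s + m' < f x y + \<phi> x"
      using m'[OF x] by force
  qed
qed

text \<open>A strict superlevel set is relatively open, so it meets a dense subset.\<close>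

lemma continuous_on_dense_above:
  fixes f :: "'b::topological_space \<Rightarrow> real"
  assumes "continuous_on Y f" "S \<subseteq> Y" "Y \<subseteq> closure S" "y \<in> Y" "r < f y"
  shows "\<exists>s\<in>S. r < f s"
proof -
  obtain U where U: "open U" "U \<inter> Y = f -` {r<..} \<inter> Y"
    using assms(1) unfolding continuous_on_open_invariant by (metis open_greaterThan)
  then have "y \<in> U \<inter> closure S" using assms(3-5) by auto
  then have "U \<inter> S \<noteq> {}" using U(1) open_Int_closure_eq_empty by blast
  then show ?thesis using U(2) assms(2) by blast
qed

theorem theorem1p2:
  fixes X :: "'e::banach set"
    and Y :: "'y::real_topological_vector_space set"
    and I J :: "'e \<Rightarrow> 'y \<Rightarrow> real"
    and \<alpha> \<beta> :: "'e \<Rightarrow> real"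
  assumes "closed X" and "X \<noteq> {}"
    and "convex Y" and "Y \<noteq> {}"
    and "\<And>x. x \<in> X \<Longrightarrow> gateaux_differentiable \<alpha> x"
    and "\<And>x. x \<in> X \<Longrightarrow> gateaux_differentiable \<beta> x"
    and "\<And>x y. x \<in> X \<Longrightarrow> y \<in> Y \<Longrightarrow> gateaux_differentiable (\<lambda>x. I x y) x"
    and "\<And>x y. x \<in> X \<Longrightarrow> y \<in> Y \<Longrightarrow> gateaux_differentiable (\<lambda>x. J x y) x"
    and "(SUP y\<in>Y. INF x\<in>X. ereal (I x y - J x y))
           < (INF x\<in>X. SUP y\<in>Y. ereal (I x y - J x y))"
    and "(SUP x\<in>X. ereal (\<alpha> x + \<beta> x)) - (INF x\<in>X. ereal (\<alpha> x + \<beta> x))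
           < (INF x\<in>X. SUP y\<in>Y. ereal (I x y - J x y))
             - (SUP y\<in>Y. INF x\<in>X. ereal (I x y - J x y))"
    and i1: "\<And>y. y \<in> Y \<Longrightarrow> lower_semicontinuous euclidean (\<lambda>x. I x y + \<alpha> x)
                         \<and> convex_on UNIV (\<lambda>x. I x y + \<alpha> x)"
    and i2: "\<exists>\<tau>. topspace \<tau> = X \<and>
               (\<forall>y\<in>Y. lower_semicontinuous \<tau> (\<lambda>x. I x y - J x y + \<alpha> x + \<beta> x)
                    \<and> inf_compact \<tau> (\<lambda>x. I x y - J x y + \<alpha> x + \<beta> x))"
    and i3: "\<And>x. x \<in> X \<Longrightarrow> continuous_on Y (\<lambda>y. I x y - J x y)
                         \<and> quasi_concave_on Y (\<lambda>y. I x y - J x y)"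
    and i4: "\<And>y u. y \<in> Y \<Longrightarrow> u \<in> X \<Longrightarrow>
               ereal (I u y - J u y + \<alpha> u + \<beta> u)
                 = (INF x\<in>X. ereal (I x y - J x y + \<alpha> x + \<beta> x)) \<Longrightarrow>
               pointwise_invariant X (\<lambda>x. J x y - \<beta> x) (\<lambda>x. I x y + \<alpha> x) u"
    and "\<And>y. y \<in> Y \<Longrightarrow> lower_semicontinuous euclidean (\<lambda>x. J x y - \<beta> x)
                     \<and> convex_on UNIV (\<lambda>x. J x y - \<beta> x)"
  shows "\<forall>S. convex S \<and> S \<subseteq> Y \<and> Y \<subseteq> closure S \<longrightarrow>
           (\<exists>y\<in>S. \<exists>x1\<in>X. \<exists>x2\<in>X. x1 \<noteq> x2 \<and>
              (\<forall>x\<in>{x1, x2}. gateaux_deriv (\<lambda>x. I x y) x - gateaux_deriv (\<lambda>x. J x y) x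
                             + gateaux_deriv \<alpha> x + gateaux_deriv \<beta> x = 0))"
proof (intro allI impI)
  fix S assume S: "convex S \<and> S \<subseteq> Y \<and> Y \<subseteq> closure S"
  \<comment> \<open>The bracketing matches the shape \<open>f x y + \<phi> x\<close> of the gap
    lemma.\<close>
  define g where "g = (\<lambda>x y. I x y - J x y + (\<alpha> x + \<beta> x))"
  obtain T where T: "topspace T = X"
    and lsc: "\<And>y. y \<in> Y \<Longrightarrow> lower_semicontinuous T (\<lambda>x. g x y)"
    and cpt: "\<And>y. y \<in> Y \<Longrightarrow> inf_compact T (\<lambda>x. g x y)"
    using i2 by (auto simp: g_def add.assoc)
  have cont: "continuous_on Y (g x)" if "x \<in> X" for x
    using i3[OF that] unfolding g_def by (intro continuous_on_add continuous_on_const) auto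
  have qc: "quasi_concave_on S (g x)" if "x \<in> X" for x
    unfolding quasi_concave_on_def
  proof
    fix \<rho>
    have "convex {y \<in> Y. \<rho> - (\<alpha> x + \<beta> x) \<le> I x y - J x y}"
      using i3[OF that] by (simp add: quasi_concave_on_def)
    then have "convex (S \<inter> {y \<in> Y. \<rho> - (\<alpha> x + \<beta> x) \<le> I x y - J x y})"
      using S by (simp add: convex_Int)
    moreover have "S \<inter> {y \<in> Y. \<rho> - (\<alpha> x + \<beta> x) \<le> I x y - J x y} = {y \<in> S. \<rho> \<le> g x y}"
      using S by (auto simp: g_def)
    ultimately show "convex {y \<in> S. \<rho> \<le> g x y}" by simp
  qed
  have "\<exists>m. \<forall>x\<in>X. m \<le> I x y - J x y + (\<alpha> x + \<beta> x)" if "y \<in> Y" for y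
    using inf_compact_attains_min[OF _ lsc[OF that] cpt[OF that]] T \<open>X \<noteq> {}\<close>
    by (auto simp: g_def)
  then obtain r where r1: "\<And>y. y \<in> Y \<Longrightarrow> \<exists>x\<in>X. g x y < r"
    and r2: "\<And>x. x \<in> X \<Longrightarrow> \<exists>y\<in>Y. r < g x y"
    using minimax_gap_level[OF \<open>X \<noteq> {}\<close> \<open>Y \<noteq> {}\<close> assms(9,10)] unfolding g_def by blast
  have "\<not> (\<exists>x\<in>topspace T. \<forall>y\<in>S. g x y \<le> r)"
  proof
    assume "\<exists>x\<in>topspace T. \<forall>y\<in>S. g x y \<le> r"
    then obtain x where x: "x \<in> X" "\<forall>y\<in>S. g x y \<le> r" using T by blast
    obtain y where "y \<in> Y" "r < g x y" using r2[OF x(1)] by blast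
    then show False
      using continuous_on_dense_above[OF cont[OF x(1)]] S x(2) by force
  qed
  moreover have "S \<noteq> {}" using S \<open>Y \<noteq> {}\<close> by auto
  \<comment> \<open>On \<open>S\<close> the minimax conclusion fails at level \<open>r\<close> while
    its other hypotheses hold, so uniqueness must fail for some \<open>y\<close>.\<close>
  ultimately have "\<not> (\<forall>y\<in>S. \<forall>x\<in>X. \<forall>x'\<in>X. (\<forall>z\<in>X. g x y \<le> g z y)
      \<longrightarrow> (\<forall>z\<in>X. g x' y \<le> g z y) \<longrightarrow> x = x')"
    using minimax_unique_minimum[of T S g r] T \<open>X \<noteq> {}\<close> S lsc cpt qc
      continuous_on_subset[OF cont] r1 by (smt (verit, best) subsetD)
  then obtain y x1 x2 where y: "y \<in> S" and x12: "x1 \<in> X" "x2 \<in> X" "x1 \<noteq> x2"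
    and min: "\<forall>z\<in>X. g x1 y \<le> g z y" "\<forall>z\<in>X. g x2 y \<le> g z y"
    by blast
  have yY: "y \<in> Y" using y S by blast
  \<comment> \<open>Every minimiser over \<open>X\<close>, even one on the boundary, is critical:
    attainment turns minimality into the infimum form that \<open>i4\<close> asks for.\<close>
  have "gateaux_deriv (\<lambda>x. I x y) u - gateaux_deriv (\<lambda>x. J x y) u
      + gateaux_deriv \<alpha> u + gateaux_deriv \<beta> u = 0"
    if u: "u \<in> X" and minu: "\<forall>z\<in>X. g u y \<le> g z y" for u
  proof -
    have "ereal (I u y - J u y + \<alpha> u + \<beta> u)
        = (INF x\<in>X. ereal (I x y - J x y + \<alpha> x + \<beta> x))"
      using u minu by (intro antisym INF_greatest INF_lower2[OF u]) (auto simp: g_def)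
    then have "pointwise_invariant X (\<lambda>x. J x y - \<beta> x) (\<lambda>x. I x y + \<alpha> x) u"
      by (rule i4[OF yY u])
    then have "gateaux_deriv (\<lambda>x. I x y + \<alpha> x) u = gateaux_deriv (\<lambda>x. J x y - \<beta> x) u"
    proof (rule pointwise_invariant_gateaux_deriv_eq)
      show "I u y + \<alpha> u - (J u y - \<beta> u) \<le> I x y + \<alpha> x - (J x y - \<beta> x)" if "x \<in> X" for x
        using minu that by (force simp: g_def)
    qed (use assms yY in \<open>auto intro: gateaux_differentiable_add gateaux_differentiable_diff\<close>)
    then show ?thesis
      using assms(5-8) u yY
      by (simp add: gateaux_deriv_add gateaux_deriv_diff algebra_simps)
  qed
  then show "\<exists>y\<in>S. \<exists>x1\<in>X. \<exists>x2\<in>X. x1 \<noteq> x2 \<and>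
              (\<forall>x\<in>{x1, x2}. gateaux_deriv (\<lambda>x. I x y) x - gateaux_deriv (\<lambda>x. J x y) x
                             + gateaux_deriv \<alpha> x + gateaux_deriv \<beta> x = 0)"
    using y x12 min by blast
qed

end
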